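(* Consider the two-stage inventory problem described in the context with $y_1=10$, $\rho=1$, $$\mathcal I_1=[1,3],\ \mu_1=2,\ \sigma_1=1,\ c_1=0,\ b_1=2,\ h_1=2;\qquad \mathcal I_2=\mathbb R_+,\ \mu_2=8,\ \sigma_2=2,\ c_2=0,\ b_2=1,\ h_2=1.$$ Let $\Pi_s^{opt}$ be the set of all optimal policies of the multistage-static problem and $\Pi_d^{opt}$ the set of all robust-w.p.1-optimal policies of the distributionally robust DP problem. Let $\tilde\Pi_s$ be the set of policies $(\tilde x_1,\tilde x_2)\in\Pi$ with $\tilde x_1=10$, with $\tilde x_2=9$ when $y_2=9$ (i.e. when $d_1=1$), and with $\tilde x_2=7$ when $y_2=7$ (i.e. when $d_1=3$). Let $\tilde\Pi_d$ be the set of policies $(\tilde x_1,\tilde x_2)\in\Pi$ with $\tilde x_1=10$, with $\tilde x_2=9$ when $y_2=9$ (i.e. when $d_1=1$), and with $\tilde x_2=8$ when $y_2=7$ (i.e. when $d_1=3$). (At all other values of $d_1$ the policies are arbitrary subject to belonging to $\Pi$.) Then $\Pi_s^{opt}=\tilde\Pi_s$, and the optimal value of the multistage-static problem is $18$. On the other hand, $\Pi_d^{opt}\subseteq\tilde\Pi_d$, and the optimal value of the distributionally robust DP problem is $17+\frac{\sqrt5}{2}>18$. Consequently, the multistage-static problem is not weakly time consistent, and the multistage-static and distributionally robust DP problems have different optimal values.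
   Context: Two-stage setting ($T=2$). $\rho\in(0,1]$ is a discount factor, $y_1\in\mathbb R$ a given initial inventory level. For $t=1,2$: $c_t,b_t,h_t\ge 0$ are ordering, backorder and holding costs; $\mathcal I_t\subseteq\mathbb R_+$ is a closed interval; $\mathcal M_t$ is the set of probability measures $Q_t$ on $\mathbb R$ with support in $\mathcal I_t$, $\mathbb E_{Q_t}[D_t]=\mu_t$, $\mathbb E_{Q_t}[D_t^2]=\mu_t^2+\sigma_t^2$. Let $\mathcal M=\{Q_1\times Q_2: Q_1\in\mathcal M_1,\ Q_2\in\mathcal M_2\}$ (product measures for $(D_1,D_2)$). Write $[a]_+=\max\{a,0\}$. Policies. $\Pi$ is the set of admissible policies $\pi=(x_1,x_2)$, where $x_1\in\mathbb R$ is a constant with $x_1\ge y_1$ and $x_2:\mathbb R_+\to\mathbb R$ is a measurable function of the first-stage demand $d_1$ with $x_2(d_1)\ge y_2(d_1):=x_1-d_1$ for all $d_1\in\mathbb R_+$. Costs. $\Psi_t(x,d)=b_t[d-x]_++h_t[x-d]_+$ and $$Z^\pi(D_1,D_2)=c_1(x_1-y_1)+\Psi_1(x_1,D_1)+\rho\big[c_2(x_2(D_1)-y_2(D_1))+\Psi_2(x_2(D_1),D_2)\big].$$ Multistage-static problem: $\inf_{\pi\in\Pi}\sup_{Q\in\mathcal M}\mathbb E_Q[Z^\pi]$; $\pi$ is optimal if it attains the infimum. Distributionally robust DP problem: $V_3\equiv0$ and, for $t=2,1$, $$V_t(y)=\inf_{x\ge y}\Big\{c_t(x-y)+\sup_{Q_t\in\mathcal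 M_t}\mathbb E_{Q_t}[\Psi_t(x,D_t)+\rho V_{t+1}(x-D_t)]\Big\},$$ $\mathcal Y_t(y)$ is the set of minimizers $x\ge y$, and the optimal value is $V_1(y_1)$. A policy $\pi\in\Pi$ is robust-w.p.1-optimal for the DP problem if $x_1\in\mathcal Y_1(y_1)$ and, for every $Q\in\mathcal M$, $x_2(D_1)\in\mathcal Y_2(y_2(D_1))$ with probability one under $Q$. Time consistency. A policy is time consistent if it is optimal for the multistage-static problem and robust-w.p.1-optimal for the DP problem. The multistage-static problem is weakly time consistent if at least one of its optimal policies is time consistent. *)

theory Defs
  imports "HOL-Probability.Probability"
begin

record inventory =
  discount :: real
  initial_level :: real
  order_cost :: "nat \<Rightarrow> real"
  backorder_cost :: "nat \<Rightarrow> real"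
  holding_cost :: "nat \<Rightarrow> real"
  demand_range :: "nat \<Rightarrow> real set"
  demand_mean :: "nat \<Rightarrow> real"
  demand_sd :: "nat \<Rightarrow> real"

definition valid_inventory :: "inventory \<Rightarrow> bool" where
  "valid_inventory P \<longleftrightarrow>
     0 < discount P \<and> discount P \<le> 1 \<and>
     (\<forall>t\<in>{1, 2}. 0 \<le> order_cost P t \<and> 0 \<le> backorder_cost P t \<and> 0 \<le> holding_cost P t \<and>
        is_interval (demand_range P t) \<and> closed (demand_range P t) \<and> demand_range P t \<subseteq> {0..})"

text \<open>
  Since \<^term>\<open>demand_range P t\<close> is closed, a Borel probability measure has its support in it
  iff it is concentrated on it.
\<close>

definition marginals :: "inventory \<Rightarrow> nat \<Rightarrow> real measure set" where
  "marginals P t = {Q. prob_space Q \<and> sets Q = sets borel \<and>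
     (AE d in Q. d \<in> demand_range P t) \<and>
     integrable Q (\<lambda>d. d) \<and> (\<integral>d. d \<partial>Q) = demand_mean P t \<and>
     integrable Q (\<lambda>d. d\<^sup>2) \<and> (\<integral>d. d\<^sup>2 \<partial>Q) = (demand_mean P t)\<^sup>2 + (demand_sd P t)\<^sup>2}"

definition joint_laws :: "inventory \<Rightarrow> (real \<times> real) measure set" where
  "joint_laws P = {Q1 \<Otimes>\<^sub>M Q2 | Q1 Q2. Q1 \<in> marginals P 1 \<and> Q2 \<in> marginals P 2}"

text \<open>
  Second-stage decisions are functions on the nonnegative reals only; extensionality makes
  their representation as total functions unique.
\<close>

type_synonym policy = "real \<times> (real \<Rightarrow> real)"

definition policies :: "inventory \<Rightarrow> policy set" where
  "policies P = {(x1, x2). initial_level P \<le> x1 \<and>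
     x2 \<in> extensional {0..} \<and> x2 \<in> borel_measurable (restrict_space borel {0..}) \<and>
     (\<forall>d1\<ge>0. x1 - d1 \<le> x2 d1)}"

definition stage_cost :: "inventory \<Rightarrow> nat \<Rightarrow> real \<Rightarrow> real \<Rightarrow> real" where
  "stage_cost P t x d = backorder_cost P t * max (d - x) 0 + holding_cost P t * max (x - d) 0"

fun total_cost :: "inventory \<Rightarrow> policy \<Rightarrow> real \<times> real \<Rightarrow> real" where
  "total_cost P (x1, x2) (d1, d2) =
     order_cost P 1 * (x1 - initial_level P) + stage_cost P 1 x1 d1 +
     discount P * (order_cost P 2 * (x2 d1 - (x1 - d1)) + stage_cost P 2 (x2 d1) d2)"

text \<open>
  For valid data all costs are nonnegative: for a policy in \<^term>\<open>policies P\<close> and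
  \<open>d1 \<ge> 0\<close>, which holds almost surely, every summand of \<^term>\<open>total_cost P\<close> is nonnegative.
  Expectations are therefore taken as \<^typ>\<open>ennreal\<close>-valued integrals, which need no
  integrability condition.
\<close>

definition worst_case_cost :: "inventory \<Rightarrow> policy \<Rightarrow> ennreal" where
  "worst_case_cost P \<pi> = (SUP Q\<in>joint_laws P. \<integral>\<^sup>+ \<omega>. ennreal (total_cost P \<pi> \<omega>) \<partial>Q)"

definition static_value :: "inventory \<Rightarrow> ennreal" where
  "static_value P = (INF \<pi>\<in>policies P. worst_case_cost P \<pi>)"

definition static_optimal :: "inventory \<Rightarrow> policy set" where
  "static_optimal P = {\<pi> \<in> policies P. worst_case_cost P \<pi> = static_value P}"

text \<open>\<open>W\<close> is the value function of the next stage.\<close>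

definition bellman_objective ::
    "inventory \<Rightarrow> nat \<Rightarrow> (real \<Rightarrow> ennreal) \<Rightarrow> real \<Rightarrow> real \<Rightarrow> ennreal" where
  "bellman_objective P t W y x =
     ennreal (order_cost P t * (x - y)) +
     (SUP Q\<in>marginals P t.
        \<integral>\<^sup>+ d. (ennreal (stage_cost P t x d) + ennreal (discount P) * W (x - d)) \<partial>Q)"

function value_fun :: "inventory \<Rightarrow> nat \<Rightarrow> real \<Rightarrow> ennreal" where
  "value_fun P t = (if t \<ge> 3 then (\<lambda>y. 0)
     else (\<lambda>y. INF x\<in>{y..}. bellman_objective P t (value_fun P (Suc t)) y x))"
  by auto
termination
  by (relation "Wellfounded.measure (\<lambda>(P, t). 3 - t)") auto

declare value_fun.simps [simp del]

definition dp_minimizers :: "inventory \<Rightarrow> nat \<Rightarrow> real \<Rightarrow> real set" where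
  "dp_minimizers P t y =
     {x. y \<le> x \<and> bellman_objective P t (value_fun P (Suc t)) y x = value_fun P t y}"

definition dp_value :: "inventory \<Rightarrow> ennreal" where
  "dp_value P = value_fun P 1 (initial_level P)"

definition dp_optimal :: "inventory \<Rightarrow> policy set" where
  "dp_optimal P = {(x1, x2) \<in> policies P.
     x1 \<in> dp_minimizers P 1 (initial_level P) \<and>
     (\<forall>Q\<in>joint_laws P. AE (d1, d2) in Q. x2 d1 \<in> dp_minimizers P 2 (x1 - d1))}"

definition time_consistent :: "inventory \<Rightarrow> policy \<Rightarrow> bool" where
  "time_consistent P \<pi> \<longleftrightarrow> \<pi> \<in> static_optimal P \<and> \<pi> \<in> dp_optimal P"

definition weakly_time_consistent :: "inventory \<Rightarrow> bool" where
  "weakly_time_consistent P \<longleftrightarrow> (\<exists>\<pi>\<in>static_optimal P. time_consistent P \<pi>)"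

definition example_inventory :: inventory where
  "example_inventory = \<lparr>
     discount = 1,
     initial_level = 10,
     order_cost = (\<lambda>t. 0),
     backorder_cost = (\<lambda>t. if t = 1 then 2 else 1),
     holding_cost = (\<lambda>t. if t = 1 then 2 else 1),
     demand_range = (\<lambda>t. if t = 1 then {1..3} else {0..}),
     demand_mean = (\<lambda>t. if t = 1 then 2 else 8),
     demand_sd = (\<lambda>t. if t = 1 then 1 else 2)\<rparr>"

lemma valid_example_inventory: "valid_inventory example_inventory"
  by (auto simp: valid_inventory_def example_inventory_def is_interval_cc is_interval_ci)

end

theory Submission imports Defs begin

text \<open>
  The range, mean and variance of \<open>D\<^sub>1\<close> leave a single law, uniform on \<open>{1, 3}\<close>, so only
  \<open>a = x\<^sub>2 1\<close> and \<open>b = x\<^sub>2 3\<close> matter. The static problem faces one law of \<open>D\<^sub>2\<close> for both \<open>a\<close> and \<open>b\<close>: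
  at \<open>a = 9\<close>, \<open>b = 7\<close> the bound \<open>\<bar>9 - d\<bar> + \<bar>7 - d\<bar> \<le> 2 + (d - 8)\<^sup>2 / 2\<close> gives the value 18, and
  whenever \<open>a + b > 16\<close> a two-point law of \<open>D\<^sub>2\<close>, slightly skewed to the right, costs strictly more.
  The dynamic program lets the adversary choose the law of \<open>D\<^sub>2\<close> after seeing \<open>d\<^sub>1\<close>; the worst case of
  \<open>E \<bar>x - D\<^sub>2\<bar>\<close> is then Scarf's bound \<open>sqrt ((x - 8)\<^sup>2 + 4)\<close>, minimized at 9 for
  \<open>y\<^sub>2 = 9\<close> and at 8 for \<open>y\<^sub>2 = 7\<close>.
\<close>

section \<open>Two-point laws\<close>

text \<open>Pushed forward to \<open>borel\<close>, because \<open>marginals\<close> demands the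
  Borel sets.\<close>

definition two_point :: "real \<Rightarrow> real \<Rightarrow> real \<Rightarrow> real measure" where
  "two_point p a b = distr (measure_pmf (bernoulli_pmf p)) borel (\<lambda>c. if c then a else b)"

lemma sets_two_point [simp]: "sets (two_point p a b) = sets borel"
  by (simp add: two_point_def)

lemma prob_space_two_point: "prob_space (two_point p a b)"
  unfolding two_point_def by (rule measure_pmf.prob_space_distr) simp

lemma integrable_two_point:
  fixes f :: "real \<Rightarrow> real"
  assumes "f \<in> borel_measurable borel"
  shows "integrable (two_point p a b) f"
  unfolding two_point_def using assms
  by (subst integrable_distr_eq) (auto intro: integrable_measure_pmf_finite)

lemma integral_two_point:
  fixes f :: "real \<Rightarrow> real"
  assumes "f \<in> borel_measurable borel" "0 \<le> p" "p \<le> 1"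
  shows "(\<integral>d. f d \<partial>two_point p a b) = p * f a + (1 - p) * f b"
  unfolding two_point_def using assms by (subst integral_distr) auto

lemma AE_two_point:
  assumes "P a" "P b" "{d. P d} \<in> sets borel"
  shows "AE d in two_point p a b. P d"
  unfolding two_point_def using assms by (subst AE_distr_iff) auto

lemma two_point_in_marginals:
  assumes "0 \<le> p" "p \<le> 1"
    and "a \<in> demand_range P t" "b \<in> demand_range P t" "closed (demand_range P t)"
    and "p * a + (1 - p) * b = demand_mean P t"
    and "p * a\<^sup>2 + (1 - p) * b\<^sup>2 = (demand_mean P t)\<^sup>2 + (demand_sd P t)\<^sup>2"
  shows "two_point p a b \<in> marginals P t"
  unfolding marginals_def using assms
  by (simp add: prob_space_two_point integrable_two_point integral_two_point AE_two_point
      borel_closed)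

section \<open>The first-stage demand\<close>

text \<open>The product \<open>(d - a) * (b - d)\<close> is nonnegative on the interval, and
  \<open>extremal\<close> says that its mean is 0, so it vanishes almost surely: the variance is the
  largest one possible for this mean.\<close>

lemma AE_endpoints:
  fixes a b :: real
  assumes "prob_space Q" "sets Q = sets borel" "AE d in Q. d \<in> {a..b}"
    and int: "integrable Q (\<lambda>d. d)" "integrable Q (\<lambda>d. d\<^sup>2)"
    and extremal: "(a + b) * (\<integral>d. d \<partial>Q) = (\<integral>d. d\<^sup>2 \<partial>Q) + a * b"
  shows "AE d in Q. d = a \<or> d = b"
proof -
  interpret prob_space Q by fact
  have eq: "(d - a) * (b - d) = (a + b) * d - d\<^sup>2 - a * b" for d
    by (simp add: algebra_simps power2_eq_square)
  have "integrable Q (\<lambda>d. (d - a) * (b - d))"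
    unfolding eq using int by simp
  moreover have "(\<integral>d. (d - a) * (b - d) \<partial>Q) = 0"
    unfolding eq using int extremal by (simp add: prob_space)
  moreover have "AE d in Q. 0 \<le> (d - a) * (b - d)"
    using assms(3) by eventually_elim auto
  ultimately have "AE d in Q. (d - a) * (b - d) = 0"
    by (simp add: integral_nonneg_eq_0_iff_AE)
  then show ?thesis by eventually_elim auto
qed

abbreviation (input) "ex \<equiv> example_inventory"

lemma first_stage_law:
  assumes "Q \<in> marginals ex 1"
  shows AE_first_stage: "AE d in Q. d = 1 \<or> d = 3"
    and emeasure_first_stage: "emeasure Q {1} = ennreal (1/2)" "emeasure Q {3} = ennreal (1/2)"
proof -
  have Q: "prob_space Q" "sets Q = sets borel" "AE d in Q. d \<in> {1..3}"
    "integrable Q (\<lambda>d. d)" "integrable Q (\<lambda>d. d\<^sup>2)" "(\<integral>d. d \<partial>Q) = 2" "(\<integral>d. d\<^sup>2 \<partial>Q) = 5"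
    using assms by (auto simp: marginals_def example_inventory_def)
  interpret prob_space Q by fact
  show AE: "AE d in Q. d = 1 \<or> d = 3"
    using AE_endpoints[of Q 1 3] Q by simp
  have [simp]: "{x} \<in> sets Q" for x :: real using Q(2) by simp
  note [measurable_cong] = Q(2)
  have [simp]: "space Q = UNIV" using sets_eq_imp_space_eq[OF Q(2)] by simp
  \<comment> \<open>The choices (1, 0) and (0, 1) for \<open>u\<close> and \<open>v\<close> give
    total mass and mean, two linear equations for the two masses.\<close>
  have affine: "(\<integral>d. u + v * d \<partial>Q) = (u + v) * prob {1} + (u + v * 3) * prob {3}" for u v :: real
  proof -
    have "(\<integral>d. u + v * d \<partial>Q) =
        (\<integral>d. (u + v) * indicator {1} d + (u + v * 3) * indicator {3} d \<partial>Q)"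
    proof (rule integral_cong_AE)
      show "AE d in Q. u + v * d = (u + v) * indicator {1} d + (u + v * 3) * indicator {3} d"
        using AE by eventually_elim auto
    qed measurable
    then show ?thesis by (simp add: emeasure_eq_measure)
  qed
  have "prob {1} + prob {3} = 1"
    using affine[of 1 0] prob_space by simp
  moreover have "prob {1} + 3 * prob {3} = 2"
    using affine[of 0 1] Q(6) by simp
  ultimately have "prob {1} = 1/2" "prob {3} = 1/2" by auto
  then show "emeasure Q {1} = ennreal (1/2)" "emeasure Q {3} = ennreal (1/2)"
    by (simp_all only: emeasure_eq_measure)
qed

text \<open>Here \<open>f\<close> is arbitrary: it agrees almost everywhere with a combination of
  two indicators. Hence the value function enters only through two of its values.\<close>

lemma nn_integral_first_stage:
  assumes "Q \<in> marginals ex 1" "f 1 = ennreal u" "f 3 = ennreal v" "0 \<le> u" "0 \<le> v"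
  shows "(\<integral>\<^sup>+ d. f d \<partial>Q) = ennreal ((u + v) / 2)"
proof -
  have sets: "{x} \<in> sets Q" for x :: real
    using assms(1) by (simp add: marginals_def)
  have "(\<integral>\<^sup>+ d. f d \<partial>Q) = (\<integral>\<^sup>+ d. f 1 * indicator {1} d + f 3 * indicator {3} d \<partial>Q)"
  proof (rule nn_integral_cong_AE)
    show "AE d in Q. f d = f 1 * indicator {1} d + f 3 * indicator {3} d"
      using AE_first_stage[OF assms(1)] by eventually_elim auto
  qed
  also have "\<dots> = f 1 * ennreal (1/2) + f 3 * ennreal (1/2)"
    using sets emeasure_first_stage[OF assms(1)]
    by (subst nn_integral_add) (auto simp: nn_integral_cmult_indicator)
  also have "\<dots> = ennreal ((u + v) / 2)"
    using assms(2-5) by (simp add: ennreal_mult[symmetric] ennreal_plus[symmetric] add_divide_distrib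
        del: ennreal_plus ennreal_half)
  finally show ?thesis .
qed

lemma marginals_first_nonempty: "two_point (1/2) 1 3 \<in> marginals ex 1"
  by (rule two_point_in_marginals) (auto simp: example_inventory_def)

section \<open>The second-stage demand\<close>

text \<open>The expected second-stage cost, as backorder and holding costs are both 1 and ordering
  is free.\<close>

definition mean_dist :: "real measure \<Rightarrow> real \<Rightarrow> real" where
  "mean_dist Q x = (\<integral>d. \<bar>x - d\<bar> \<partial>Q)"

lemma mean_dist_nonneg: "0 \<le> mean_dist Q x"
  by (simp add: mean_dist_def)

lemma marginals_secondD:
  assumes "Q \<in> marginals ex 2"
  shows "prob_space Q" "sets Q = sets borel" "integrable Q (\<lambda>d. d)" "integrable Q (\<lambda>d. d\<^sup>2)"
    and "(\<integral>d. d \<partial>Q) = 8" "(\<integral>d. d\<^sup>2 \<partial>Q) = 68"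
  using assms by (auto simp: marginals_def example_inventory_def)

lemma integrable_dist_second:
  assumes "Q \<in> marginals ex 2"
  shows "integrable Q (\<lambda>d. \<bar>x - d\<bar> :: real)"
proof -
  interpret prob_space Q using marginals_secondD[OF assms] by simp
  show ?thesis using marginals_secondD[OF assms] by simp
qed

lemma nn_integral_dist_second:
  assumes "Q \<in> marginals ex 2" "0 \<le> c"
  shows "(\<integral>\<^sup>+ d. ennreal (c + \<bar>x - d\<bar>) \<partial>Q) = ennreal (c + mean_dist Q x)"
proof -
  interpret prob_space Q using marginals_secondD[OF assms(1)] by simp
  show ?thesis
    using integrable_dist_second[OF assms(1)] assms(2)
    by (subst nn_integral_eq_integral) (auto simp: prob_space mean_dist_def)
qed

text \<open>Weak duality for the moment problem: the mean of a quadratic majorant depends only on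
  the two prescribed moments. Both upper bounds on the adversary rest on it.\<close>

lemma integral_second_le_quadratic:
  assumes "Q \<in> marginals ex 2" "\<And>d. f d \<le> u + v * (x - d)\<^sup>2" "integrable Q f"
  shows "(\<integral>d. f d \<partial>Q) \<le> u + v * ((x - 8)\<^sup>2 + 4)"
proof -
  note Q = marginals_secondD[OF assms(1)]
  interpret prob_space Q using Q by simp
  have eq: "u + v * (x - d)\<^sup>2 = (u + v * x\<^sup>2) - (2 * v * x) * d + v * d\<^sup>2" for d
    by (simp add: algebra_simps power2_eq_square)
  have "(\<integral>d. f d \<partial>Q) \<le> (\<integral>d. u + v * (x - d)\<^sup>2 \<partial>Q)"
    using Q assms by (intro integral_mono) (auto simp: eq)
  also have "\<dots> = u + v * ((x - 8)\<^sup>2 + 4)"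
    unfolding eq using Q by (simp add: prob_space) (simp add: algebra_simps power2_eq_square)
  finally show ?thesis .
qed

text \<open>These are all the two-point laws with mean 8 and standard deviation 2; \<open>t\<close>
  is the distance of the lower atom from the mean in standard deviations. At \<open>t = 1\<close>
  the law is uniform on 6 and 10.\<close>

definition skewed_law :: "real \<Rightarrow> real measure" where
  "skewed_law t = two_point (1 / (1 + t\<^sup>2)) (8 - 2 * t) (8 + 2 / t)"

text \<open>The bound \<open>t \<le> 4\<close> keeps the lower atom nonnegative.\<close>

lemma skewed_law_in_marginals:
  assumes "0 < t" "t \<le> 4"
  shows "skewed_law t \<in> marginals ex 2"
proof -
  have pos: "0 < 1 + t\<^sup>2" by (simp add: add_pos_nonneg)
  then have nz: "1 + t\<^sup>2 \<noteq> 0" by simp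
  have q: "1 - 1 / (1 + t\<^sup>2) = t\<^sup>2 / (1 + t\<^sup>2)" using pos by (simp add: field_simps)
  have [simp]: "demand_range ex 2 = {0..}" "demand_mean ex 2 = 8" "demand_sd ex 2 = 2"
    by (simp_all add: example_inventory_def)
  have mean: "1 / (1 + t\<^sup>2) * (8 - 2 * t) + t\<^sup>2 / (1 + t\<^sup>2) * (8 + 2 / t) = 8"
  proof -
    have "1 / (1 + t\<^sup>2) * (8 - 2 * t) + t\<^sup>2 / (1 + t\<^sup>2) * (8 + 2 / t)
      = ((8 - 2 * t) + t\<^sup>2 * (8 + 2 / t)) / (1 + t\<^sup>2)" by (simp add: add_divide_distrib)
    also have "(8 - 2 * t) + t\<^sup>2 * (8 + 2 / t) = 8 * (1 + t\<^sup>2)"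
      using assms by (simp add: field_simps power2_eq_square)
    also have "8 * (1 + t\<^sup>2) / (1 + t\<^sup>2) = 8" using nz by (simp add: nonzero_divide_eq_eq)
    finally show ?thesis .
  qed
  have moment: "1 / (1 + t\<^sup>2) * (8 - 2 * t)\<^sup>2 + t\<^sup>2 / (1 + t\<^sup>2) * (8 + 2 / t)\<^sup>2 = 68"
  proof -
    have "1 / (1 + t\<^sup>2) * (8 - 2 * t)\<^sup>2 + t\<^sup>2 / (1 + t\<^sup>2) * (8 + 2 / t)\<^sup>2
      = ((8 - 2 * t)\<^sup>2 + t\<^sup>2 * (8 + 2 / t)\<^sup>2) / (1 + t\<^sup>2)" by (simp add: add_divide_distrib)
    also have "(8 - 2 * t)\<^sup>2 + t\<^sup>2 * (8 + 2 / t)\<^sup>2 = 68 * (1 + t\<^sup>2)"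
      using assms by (simp add: field_simps power2_eq_square)
    also have "68 * (1 + t\<^sup>2) / (1 + t\<^sup>2) = 68" using nz by (simp add: nonzero_divide_eq_eq)
    finally show ?thesis .
  qed
  show ?thesis
    unfolding skewed_law_def
    using assms pos mean moment
    by (intro two_point_in_marginals) (simp_all add: q)
qed

text \<open>For \<open>x\<close> between the two atoms this is an equality.\<close>

lemma skewed_law_dist_ge:
  assumes "0 < t"
  shows "(4 * t + (x - 8) * (1 - t\<^sup>2)) / (1 + t\<^sup>2) \<le> mean_dist (skewed_law t) x"
proof -
  have pos: "0 < 1 + t\<^sup>2" by (simp add: add_pos_nonneg)
  have q: "1 - 1 / (1 + t\<^sup>2) = t\<^sup>2 / (1 + t\<^sup>2)" using pos by (simp add: field_simps)
  have "(4 * t + (x - 8) * (1 - t\<^sup>2)) = (x - (8 - 2 * t)) + t\<^sup>2 * ((8 + 2 / t) - x)"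
    using assms by (simp add: field_simps power2_eq_square)
  also have "\<dots> \<le> \<bar>x - (8 - 2 * t)\<bar> + t\<^sup>2 * \<bar>x - (8 + 2 / t)\<bar>"
    by (intro add_mono mult_left_mono) auto
  finally have "(4 * t + (x - 8) * (1 - t\<^sup>2)) / (1 + t\<^sup>2)
      \<le> (\<bar>x - (8 - 2 * t)\<bar> + t\<^sup>2 * \<bar>x - (8 + 2 / t)\<bar>) / (1 + t\<^sup>2)"
    using pos by (intro divide_right_mono) auto
  also have "\<dots> = mean_dist (skewed_law t) x"
    unfolding mean_dist_def skewed_law_def using pos
    by (subst integral_two_point) (auto simp: q add_divide_distrib)
  finally show ?thesis .
qed

section \<open>The dynamic program\<close>

text \<open>With \<open>s\<close> the root mean square of the distance, the inequality of arithmetic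
  and geometric means yields a quadratic majorant touching the distance at \<open>s\<close>; its
  mean is \<open>s / 2 + s / 2\<close>.\<close>

lemma Scarf_upper:
  assumes "Q \<in> marginals ex 2"
  shows "mean_dist Q x \<le> sqrt ((x - 8)\<^sup>2 + 4)"
proof -
  define s where "s = sqrt ((x - 8)\<^sup>2 + 4)"
  have s: "0 < s" "s * s = (x - 8)\<^sup>2 + 4"
    unfolding s_def by (simp_all add: add_nonneg_pos)
  have "\<bar>x - d\<bar> \<le> s / 2 + 1 / (2 * s) * (x - d)\<^sup>2" for d
  proof -
    have "0 \<le> (\<bar>x - d\<bar> - s)\<^sup>2" by simp
    then have "2 * s * \<bar>x - d\<bar> \<le> s * s + (x - d)\<^sup>2"
      unfolding power2_diff[of "\<bar>x - d\<bar>" s] power2_abs by (simp add: power2_eq_square[of s] ac_simps)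
    then show ?thesis using s(1) by (simp add: field_simps power2_eq_square)
  qed
  from integral_second_le_quadratic[OF assms this integrable_dist_second[OF assms]]
  have "mean_dist Q x \<le> s / 2 + 1 / (2 * s) * (s * s)"
    by (simp only: s(2) mean_dist_def)
  then show ?thesis using s(1) by (simp add: s_def[symmetric])
qed

text \<open>Equality in Scarf's bound forces the atoms to be \<open>x \<plusminus> sqrt ((x - 8)\<^sup>2 + 4)\<close>; this determines \<open>t\<close>.\<close>

lemma Scarf_attained:
  assumes "7 \<le> x"
  shows "\<exists>Q\<in>marginals ex 2. sqrt ((x - 8)\<^sup>2 + 4) \<le> mean_dist Q x"
proof -
  define s where "s = sqrt ((x - 8)\<^sup>2 + 4)"
  define t where "t = (s - (x - 8)) / 2"
  have ss: "s * s = (x - 8)\<^sup>2 + 4" unfolding s_def by simp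
  have "x - 8 < s" unfolding s_def by (rule real_less_rsqrt) simp
  then have t0: "0 < t" by (simp add: t_def)
  \<comment> \<open>The lower atom \<open>8 - 2 * t\<close> is \<open>x - s\<close>, so this makes
    it nonnegative.\<close>
  have "s \<le> x" unfolding s_def
    using assms by (intro real_le_lsqrt) (auto simp: power2_eq_square algebra_simps)
  then have t4: "t \<le> 4" by (simp add: t_def)
  \<comment> \<open>So \<open>t\<close> is the positive root of a quadratic; reducing by it turns
    the lower bound into \<open>t * s * s\<close> over \<open>t * s\<close>.\<close>
  have sq: "t\<^sup>2 = 1 - (x - 8) * t"
    unfolding t_def using ss by (simp add: power2_eq_square field_simps)
  have "4 * t + (x - 8) * (1 - t\<^sup>2) = t * (s * s)"
    unfolding sq ss by (simp add: power2_eq_square algebra_simps)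
  moreover have "1 + t\<^sup>2 = t * s"
  proof -
    have "2 * t + (x - 8) = s" by (simp add: t_def field_simps)
    then have "t * s = t * (2 * t + (x - 8))" by simp
    then show ?thesis using sq by (simp add: power2_eq_square algebra_simps)
  qed
  moreover have "s \<noteq> 0"
  proof
    assume "s = 0"
    then show False using ss by (simp add: add_nonneg_eq_0_iff)
  qed
  ultimately have "(4 * t + (x - 8) * (1 - t\<^sup>2)) / (1 + t\<^sup>2) = s"
    using t0 by simp
  then have "s \<le> mean_dist (skewed_law t) x"
    using skewed_law_dist_ge[OF t0, of x] by simp
  then show ?thesis
    using skewed_law_in_marginals[OF t0 t4] unfolding s_def by blast
qed

text \<open>Ordering is free, so \<open>y\<close> drops out. Levels from 7 up suffice: the first
  stage starts at 10 or more and loses at most 3 almost surely.\<close>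

lemma bellman_second:
  assumes "7 \<le> x"
  shows "bellman_objective ex 2 (value_fun ex (Suc 2)) y x = ennreal (sqrt ((x - 8)\<^sup>2 + 4))"
proof -
  have cost: "ennreal (stage_cost ex 2 x d) + ennreal (discount ex) * value_fun ex (Suc 2) (x - d)
      = ennreal (0 + \<bar>x - d\<bar>)" for d
  proof -
    have "stage_cost ex 2 x d = 0 + \<bar>x - d\<bar>"
      by (auto simp: stage_cost_def example_inventory_def)
    moreover have "value_fun ex (Suc 2) = (\<lambda>y. 0)"
      by (subst value_fun.simps) simp
    ultimately show ?thesis by simp
  qed
  have "bellman_objective ex 2 (value_fun ex (Suc 2)) y x =
      (SUP Q\<in>marginals ex 2. ennreal (mean_dist Q x))"
    unfolding bellman_objective_def cost
    by (simp add: nn_integral_dist_second[where c = 0, simplified])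
      (simp add: example_inventory_def)
  also have "\<dots> = ennreal (sqrt ((x - 8)\<^sup>2 + 4))"
    using Scarf_attained[OF assms]
    by (intro antisym SUP_least ennreal_leI Scarf_upper) (auto intro: SUP_upper2 ennreal_leI)
  finally show ?thesis .
qed

lemma value_second:
  assumes "7 \<le> y"
  shows "value_fun ex 2 y = ennreal (sqrt ((max y 8 - 8)\<^sup>2 + 4))"
proof -
  have "value_fun ex 2 y = (INF x\<in>{y..}. ennreal (sqrt ((x - 8)\<^sup>2 + 4)))"
    using assms by (subst value_fun.simps) (auto intro!: INF_cong simp: bellman_second[simplified])
  also have "\<dots> = ennreal (sqrt ((max y 8 - 8)\<^sup>2 + 4))"
  proof (rule antisym)
    show "(INF x\<in>{y..}. ennreal (sqrt ((x - 8)\<^sup>2 + 4))) \<le> ennreal (sqrt ((max y 8 - 8)\<^sup>2 + 4))"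
      by (rule INF_lower) simp
    show "ennreal (sqrt ((max y 8 - 8)\<^sup>2 + 4)) \<le> (INF x\<in>{y..}. ennreal (sqrt ((x - 8)\<^sup>2 + 4)))"
      by (rule INF_greatest) (auto intro!: ennreal_leI power_mono simp: max_def)
  qed
  finally show ?thesis .
qed

lemma dp_minimizers_second:
  assumes "7 \<le> y"
  shows "dp_minimizers ex 2 y \<subseteq> {max y 8}"
proof
  fix x assume "x \<in> dp_minimizers ex 2 y"
  then have x: "y \<le> x"
    and "ennreal (sqrt ((x - 8)\<^sup>2 + 4)) = ennreal (sqrt ((max y 8 - 8)\<^sup>2 + 4))"
    using assms by (auto simp: dp_minimizers_def bellman_second[simplified] value_second)
  then have "(x - 8)\<^sup>2 = (max y 8 - 8)\<^sup>2" by simp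
  then have "x - 8 = max y 8 - 8 \<or> x - 8 = - (max y 8 - 8)" by (simp only: power2_eq_iff)
  \<comment> \<open>The mirror image in 8 lies below \<open>y\<close> unless it coincides with
    \<open>max y 8\<close>.\<close>
  then show "x \<in> {max y 8}" using x by (auto simp: max_def split: if_splits)
qed

text \<open>The average over demands 1 and 3 of holding cost plus second-stage value. The first root
  has no \<open>max\<close>, since \<open>x - 1\<close> is at least 9.\<close>

definition dp_cost :: "real \<Rightarrow> real" where
  "dp_cost x = 2 * x - 4 + (sqrt ((x - 9)\<^sup>2 + 4) + sqrt ((max (x - 3) 8 - 8)\<^sup>2 + 4)) / 2"

lemma bellman_first:
  assumes "10 \<le> x"
  shows "bellman_objective ex 1 (value_fun ex (Suc 1)) y x = ennreal (dp_cost x)"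
proof -
  define f where "f d = ennreal (stage_cost ex 1 x d) +
    ennreal (discount ex) * value_fun ex (Suc 1) (x - d)" for d
  have [simp]: "discount ex = 1" "Suc (Suc 0) = 2"
    by (simp_all add: example_inventory_def)
  have "stage_cost ex 1 x 1 = 2 * (x - 1)" "max (x - 1) 8 - 8 = x - 9"
    using assms by (simp_all add: stage_cost_def example_inventory_def)
  then have f1: "f 1 = ennreal (2 * (x - 1) + sqrt ((x - 9)\<^sup>2 + 4))"
    using assms unfolding f_def by (simp add: value_second)
  have "stage_cost ex 1 x 3 = 2 * (x - 3)"
    using assms by (simp add: stage_cost_def example_inventory_def)
  then have f3: "f 3 = ennreal (2 * (x - 3) + sqrt ((max (x - 3) 8 - 8)\<^sup>2 + 4))"
    using assms unfolding f_def by (simp add: value_second)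
  have eq: "(2 * (x - 1) + sqrt ((x - 9)\<^sup>2 + 4) +
      (2 * (x - 3) + sqrt ((max (x - 3) 8 - 8)\<^sup>2 + 4))) / 2 = dp_cost x"
    unfolding dp_cost_def by (simp add: field_simps)
  have "(\<integral>\<^sup>+ d. f d \<partial>Q) = ennreal (dp_cost x)" if "Q \<in> marginals ex 1" for Q
    using nn_integral_first_stage[OF that f1 f3] assms unfolding eq by simp
  then have "(SUP Q\<in>marginals ex 1. \<integral>\<^sup>+ d. f d \<partial>Q) = ennreal (dp_cost x)"
    using marginals_first_nonempty by (intro SUP_eq_const) auto
  moreover have "order_cost ex 1 = 0" by (simp add: example_inventory_def)
  ultimately show ?thesis unfolding bellman_objective_def f_def by simp
qed

lemma dp_cost_10: "dp_cost 10 = 17 + sqrt 5 / 2"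
  by (simp add: dp_cost_def)

text \<open>Neither root falls below its value at 10, and the holding cost has slope 2; the linear
  term makes the minimizer unique.\<close>

lemma dp_cost_ge:
  assumes "10 \<le> x"
  shows "2 * (x - 10) + dp_cost 10 \<le> dp_cost x"
proof -
  have "1 \<le> (x - 9)\<^sup>2" using assms by simp
  then have "sqrt 5 \<le> sqrt ((x - 9)\<^sup>2 + 4)" by simp
  moreover have "2 \<le> sqrt ((max (x - 3) 8 - 8)\<^sup>2 + 4)" by (rule real_le_rsqrt) simp
  ultimately show ?thesis unfolding dp_cost_10 unfolding dp_cost_def by argo
qed

lemma value_first: "value_fun ex 1 10 = ennreal (dp_cost 10)"
proof -
  have "value_fun ex 1 10 = (INF x\<in>{10..}. ennreal (dp_cost x))"
    by (subst value_fun.simps) (auto intro!: INF_cong simp: bellman_first[simplified])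
  also have "\<dots> = ennreal (dp_cost 10)"
  proof (rule antisym)
    show "(INF x\<in>{10..}. ennreal (dp_cost x)) \<le> ennreal (dp_cost 10)"
      by (rule INF_lower) simp
    show "ennreal (dp_cost 10) \<le> (INF x\<in>{10..}. ennreal (dp_cost x))"
      using dp_cost_ge by (intro INF_greatest ennreal_leI) fastforce
  qed
  finally show ?thesis .
qed

lemma dp_minimizers_first: "dp_minimizers ex 1 10 \<subseteq> {10}"
proof
  fix x assume "x \<in> dp_minimizers ex 1 10"
  then have x: "10 \<le> x" and "ennreal (dp_cost x) = ennreal (dp_cost 10)"
    by (auto simp: dp_minimizers_def bellman_first[simplified] value_first[simplified])
  moreover have "0 \<le> dp_cost 10" by (simp add: dp_cost_10)
  ultimately have "dp_cost x = dp_cost 10" using dp_cost_ge[OF x] by simp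
  then show "x \<in> {10}" using x dp_cost_ge[OF x] by simp
qed

text \<open>Each atom has positive mass, so almost sure optimality of \<open>x2\<close> becomes
  optimality at demands 1 and 3.\<close>

lemma AE_first_stage_atom:
  assumes "Q \<in> marginals ex 1" "AE d in Q. P d" "c = 1 \<or> c = 3"
  shows "P c"
proof (rule ccontr)
  assume "\<not> P c"
  with assms(2) have "AE d in Q. d \<notin> {c}" by (auto elim!: eventually_mono)
  moreover have "{c} \<in> sets Q" using assms(1) by (simp add: marginals_def)
  ultimately have "emeasure Q {c} = 0"
    using sets.sets_into_space[of "{c}" Q] by (subst (asm) AE_iff_measurable[of "{c}"]) auto
  then show False using emeasure_first_stage[OF assms(1)] assms(3) by auto
qed

lemma dp_optimal_subset:
  "dp_optimal ex \<subseteq> {(x1, x2) \<in> policies ex. x1 = 10 \<and> x2 1 = 9 \<and> x2 3 = 8}"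
proof clarify
  fix x1 x2 assume "(x1, x2) \<in> dp_optimal ex"
  then have pol: "(x1, x2) \<in> policies ex"
    and "x1 \<in> dp_minimizers ex 1 (initial_level ex)"
    and AE: "\<And>Q. Q \<in> joint_laws ex \<Longrightarrow> AE (d1, d2) in Q. x2 d1 \<in> dp_minimizers ex 2 (x1 - d1)"
    by (auto simp: dp_optimal_def)
  then have x1: "x1 = 10"
    using dp_minimizers_first by (auto simp: example_inventory_def)
  \<comment> \<open>A single joint law already yields the necessary conditions; the second factor
    only has to be admissible.\<close>
  let ?Q1 = "two_point (1/2) 1 3" and ?Q2 = "skewed_law 1"
  have Q: "?Q1 \<in> marginals ex 1" "?Q2 \<in> marginals ex 2"
    using marginals_first_nonempty skewed_law_in_marginals[of 1] by auto
  interpret Q1: prob_space ?Q1 by (rule prob_space_two_point)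
  interpret Q2: prob_space ?Q2 using marginals_secondD[OF Q(2)] by simp
  interpret pair_sigma_finite ?Q1 ?Q2 ..
  have "?Q1 \<Otimes>\<^sub>M ?Q2 \<in> joint_laws ex"
    using Q by (auto simp: joint_laws_def)
  from AE_pair[OF AE[OF this]]
  have "AE d1 in ?Q1. x2 d1 \<in> dp_minimizers ex 2 (x1 - d1)"
    by auto
  from AE_first_stage_atom[OF Q(1) this]
  have "x2 1 \<in> dp_minimizers ex 2 9" "x2 3 \<in> dp_minimizers ex 2 7"
    using x1 by force+
  then show "(x1, x2) \<in> policies ex \<and> x1 = 10 \<and> x2 1 = 9 \<and> x2 3 = 8"
    using pol x1 dp_minimizers_second[of 9] dp_minimizers_second[of 7] by auto
qed

section \<open>The static problem\<close>

text \<open>Extensionality makes \<open>x2\<close> constant on the negative reals.\<close>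

lemma policy_decision_measurable:
  assumes "(x1, x2) \<in> policies P"
  shows "x2 \<in> borel_measurable borel"
proof -
  have "x2 = (\<lambda>d. if d \<in> {0..} then x2 d else undefined)"
    using assms by (auto simp: policies_def extensional_def)
  moreover have "(\<lambda>d. if d \<in> {0..} then x2 d else undefined) \<in> borel_measurable borel"
    using assms
    by (subst measurable_If_restrict_space_iff) (auto simp: policies_def atLeast_def[symmetric])
  ultimately show ?thesis by simp
qed

text \<open>Fubini reduces the cost to the two atoms of the first demand. In a product law the same
  \<open>Q\<close> then faces both decisions, whereas the dynamic program takes a supremum for
  each.\<close>

lemma worst_case_cost_eq:
  assumes pol: "(x1, x2) \<in> policies ex"
  shows "worst_case_cost ex (x1, x2) = (SUP Q\<in>marginals ex 2.
    ennreal (2 * x1 - 4 + (mean_dist Q (x2 1) + mean_dist Q (x2 3)) / 2))"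
proof -
  note [measurable] = policy_decision_measurable[OF pol]
  have x1: "10 \<le> x1" using pol by (simp add: policies_def example_inventory_def)
  have "(\<integral>\<^sup>+ \<omega>. ennreal (total_cost ex (x1, x2) \<omega>) \<partial>(Q1 \<Otimes>\<^sub>M Q2)) =
      ennreal (2 * x1 - 4 + (mean_dist Q2 (x2 1) + mean_dist Q2 (x2 3)) / 2)"
    if Q1: "Q1 \<in> marginals ex 1" and Q2: "Q2 \<in> marginals ex 2" for Q1 Q2
  proof -
    interpret Q2: prob_space Q2 using marginals_secondD[OF Q2] by simp
    have sets [measurable_cong]: "sets Q1 = sets borel" "sets Q2 = sets borel"
      using Q1 Q2 by (auto simp: marginals_def)
    have "total_cost ex (x1, x2) = (\<lambda>(d1, d2). stage_cost ex 1 x1 d1 + stage_cost ex 2 (x2 d1) d2)"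
      by (auto simp: fun_eq_iff example_inventory_def)
    then have "(\<lambda>\<omega>. ennreal (total_cost ex (x1, x2) \<omega>)) \<in> borel_measurable (Q1 \<Otimes>\<^sub>M Q2)"
      by (simp add: stage_cost_def)
    then have "(\<integral>\<^sup>+ \<omega>. ennreal (total_cost ex (x1, x2) \<omega>) \<partial>(Q1 \<Otimes>\<^sub>M Q2)) =
        (\<integral>\<^sup>+ d1. \<integral>\<^sup>+ d2. ennreal (total_cost ex (x1, x2) (d1, d2)) \<partial>Q2 \<partial>Q1)"
      by (rule Q2.nn_integral_fst[symmetric])
    also have "\<dots> = ennreal ((2 * (x1 - 1) + mean_dist Q2 (x2 1) +
        (2 * (x1 - 3) + mean_dist Q2 (x2 3))) / 2)"
    proof (rule nn_integral_first_stage[OF Q1])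
      have cost: "total_cost ex (x1, x2) (d1, d2) = 2 * (x1 - d1) + \<bar>x2 d1 - d2\<bar>"
        if "d1 \<le> 3" for d1 d2
        using that x1 by (auto simp: stage_cost_def example_inventory_def max_def)
      show "(\<integral>\<^sup>+ d2. ennreal (total_cost ex (x1, x2) (1, d2)) \<partial>Q2) =
          ennreal (2 * (x1 - 1) + mean_dist Q2 (x2 1))"
        using x1 cost[of 1] nn_integral_dist_second[OF Q2, of "2 * (x1 - 1)" "x2 1"]
        by (simp del: total_cost.simps)
      show "(\<integral>\<^sup>+ d2. ennreal (total_cost ex (x1, x2) (3, d2)) \<partial>Q2) =
          ennreal (2 * (x1 - 3) + mean_dist Q2 (x2 3))"
        using x1 cost[of 3] nn_integral_dist_second[OF Q2, of "2 * (x1 - 3)" "x2 3"]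
        by (simp del: total_cost.simps)
    qed (use x1 in \<open>auto intro!: add_nonneg_nonneg mean_dist_nonneg\<close>)
    finally show ?thesis by (simp add: field_simps)
  qed
  note joint = this
  show ?thesis unfolding worst_case_cost_def
  proof (rule antisym)
    show "(SUP Q\<in>joint_laws ex. \<integral>\<^sup>+ \<omega>. ennreal (total_cost ex (x1, x2) \<omega>) \<partial>Q) \<le>
      (SUP Q\<in>marginals ex 2.
        ennreal (2 * x1 - 4 + (mean_dist Q (x2 1) + mean_dist Q (x2 3)) / 2))"
      by (rule SUP_least) (auto simp: joint_laws_def joint simp del: total_cost.simps
          intro: SUP_upper)
    show "(SUP Q\<in>marginals ex 2.
        ennreal (2 * x1 - 4 + (mean_dist Q (x2 1) + mean_dist Q (x2 3)) / 2)) \<le>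
      (SUP Q\<in>joint_laws ex. \<integral>\<^sup>+ \<omega>. ennreal (total_cost ex (x1, x2) \<omega>) \<partial>Q)"
      using marginals_first_nonempty
      by (intro SUP_least SUP_upper2[where i = "two_point (1/2) 1 3 \<Otimes>\<^sub>M Q" for Q])
        (auto simp: joint_laws_def joint simp del: total_cost.simps)
  qed
qed

lemma worst_case_cost_18:
  assumes "(10, x2) \<in> policies ex" "x2 1 = 9" "x2 3 = 7"
  shows "worst_case_cost ex (10, x2) \<le> 18"
  unfolding worst_case_cost_eq[OF assms(1)]
proof (rule SUP_least)
  fix Q assume Q: "Q \<in> marginals ex 2"
  \<comment> \<open>The left side is the larger of 2 and \<open>2 * \<bar>8 - d\<bar>\<close>; the
    quadratic touches it at 6, 8 and 10 and has mean 4.\<close>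
  have bound: "\<bar>9 - d\<bar> + \<bar>7 - d\<bar> \<le> 2 + 1/2 * (8 - d)\<^sup>2" for d :: real
  proof -
    have "0 \<le> (\<bar>8 - d\<bar> - 2)\<^sup>2" "0 \<le> (8 - d)\<^sup>2" by simp_all
    then have "2 * \<bar>8 - d\<bar> \<le> 2 + 1/2 * (8 - d)\<^sup>2" "2 \<le> 2 + 1/2 * (8 - d)\<^sup>2"
      unfolding power2_diff[of "\<bar>8 - d\<bar>" 2] power2_abs by simp_all
    then show ?thesis by argo
  qed
  note int = integrable_dist_second[OF Q]
  have "mean_dist Q 9 + mean_dist Q 7 \<le> 4"
    using integral_second_le_quadratic[OF Q bound] int by (simp add: mean_dist_def)
  then have "ennreal (2 * 10 - 4 + (mean_dist Q 9 + mean_dist Q 7) / 2) \<le> ennreal 18"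
    by (intro ennreal_leI) simp
  then show "ennreal (2 * 10 - 4 + (mean_dist Q (x2 1) + mean_dist Q (x2 3)) / 2) \<le> 18"
    by (simp add: assms)
qed

text \<open>
  With \<open>w = (a + b) / 2 - 8\<close>, the skewed law with parameter \<open>t\<close> costs at least
  \<open>(4 * t + w * (1 - t\<^sup>2)) / (1 + t\<^sup>2)\<close>, which exceeds 2 iff \<open>w * (1 + t) > 2 * (1 - t)\<close> for \<open>t < 1\<close>;
  \<open>t = 2 / (2 + w)\<close> satisfies this if \<open>w > 0\<close>.
\<close>

lemma second_stage_cost_gt:
  fixes a b :: real
  assumes "16 < a + b"
  shows "\<exists>Q\<in>marginals ex 2. 4 < mean_dist Q a + mean_dist Q b"
proof -
  define w where "w = (a + b) / 2 - 8"
  define t where "t = 2 / (2 + w)"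
  have w: "0 < w" using assms by (simp add: w_def)
  then have t: "0 < t" "t < 1" by (simp_all add: t_def)
  have pos: "0 < 1 + t\<^sup>2" by (simp add: add_pos_nonneg)
  have tw: "t * w = 2 - 2 * t"
    unfolding t_def using w by (simp add: field_simps)
  have "0 < w * (1 - t)" using w t by simp
  \<comment> \<open>By \<open>tw\<close> the second factor equals \<open>w\<close>. The product is
    the numerator of the lower bound minus twice its denominator.\<close>
  then have "0 < (1 - t) * (w * (1 + t) - 2 * (1 - t))"
    using tw w t by (intro mult_pos_pos) (auto simp: algebra_simps)
  then have "2 * (1 + t\<^sup>2) < 4 * t + w * (1 - t\<^sup>2)"
    by (simp add: algebra_simps power2_eq_square)
  then have "4 < 2 * ((4 * t + w * (1 - t\<^sup>2)) / (1 + t\<^sup>2))"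
    using pos by (simp add: field_simps)
  also have "\<dots> = (4 * t + (a - 8) * (1 - t\<^sup>2)) / (1 + t\<^sup>2) + (4 * t + (b - 8) * (1 - t\<^sup>2)) / (1 + t\<^sup>2)"
    unfolding add_divide_distrib[symmetric] w_def times_divide_eq_right
    by (rule arg_cong[where f = "\<lambda>z. z / _"]) algebra
  also have "\<dots> \<le> mean_dist (skewed_law t) a + mean_dist (skewed_law t) b"
    by (intro add_mono skewed_law_dist_ge t)
  finally show ?thesis
    using skewed_law_in_marginals[of t] t by force
qed

text \<open>Feasibility forces \<open>x2 1 + x2 3\<close> to be at least 16, with equality only for
  the claimed values. Above 16 a skewed law costs more than 18; at 16 the symmetric law costs at
  least 18.\<close>

lemma worst_case_cost_ge:
  assumes pol: "(x1, x2) \<in> policies ex"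
  shows "18 \<le> worst_case_cost ex (x1, x2)"
    and "worst_case_cost ex (x1, x2) = 18 \<Longrightarrow> x1 = 10 \<and> x2 1 = 9 \<and> x2 3 = 7"
proof -
  have x1: "10 \<le> x1" and x2: "x1 - 1 \<le> x2 1" "x1 - 3 \<le> x2 3"
    using pol by (auto simp: policies_def example_inventory_def)
  have strict: "18 < worst_case_cost ex (x1, x2)" if gt: "16 < x2 1 + x2 3"
  proof -
    obtain Q where Q: "Q \<in> marginals ex 2"
      and "4 < mean_dist Q (x2 1) + mean_dist Q (x2 3)"
      using second_stage_cost_gt[OF gt] by blast
    then have "ennreal 18 <
        ennreal (2 * x1 - 4 + (mean_dist Q (x2 1) + mean_dist Q (x2 3)) / 2)"
      using x1 by (intro ennreal_lessI) (simp_all add: field_simps)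
    also have "\<dots> \<le> worst_case_cost ex (x1, x2)"
      unfolding worst_case_cost_eq[OF pol] by (rule SUP_upper[OF Q])
    finally show ?thesis by simp
  qed
  have tight: "x1 = 10 \<and> x2 1 = 9 \<and> x2 3 = 7" if "\<not> 16 < x2 1 + x2 3"
    using that x1 x2 by auto
  show "18 \<le> worst_case_cost ex (x1, x2)"
  proof (cases "16 < x2 1 + x2 3")
    case False
    let ?Q = "skewed_law 1"
    have Q: "?Q \<in> marginals ex 2" using skewed_law_in_marginals[of 1] by simp
    \<comment> \<open>At \<open>t = 1\<close> the coefficient of \<open>x - 8\<close> vanishes, so
      the bound is uniform in \<open>x\<close>.\<close>
    have "2 \<le> mean_dist ?Q x" for x
      using skewed_law_dist_ge[of 1 x] by simp
    from this[of "x2 1"] this[of "x2 3"] x1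
    have "ennreal 18 \<le>
        ennreal (2 * x1 - 4 + (mean_dist ?Q (x2 1) + mean_dist ?Q (x2 3)) / 2)"
      by (intro ennreal_leI) (simp add: field_simps)
    also have "\<dots> \<le> worst_case_cost ex (x1, x2)"
      unfolding worst_case_cost_eq[OF pol] by (rule SUP_upper[OF Q])
    finally show ?thesis by simp
  qed (use strict in auto)
  show "x1 = 10 \<and> x2 1 = 9 \<and> x2 3 = 7" if "worst_case_cost ex (x1, x2) = 18"
    using strict tight that by auto
qed

text \<open>The witness for the value 18: never ordering leaves levels 9 and 7.\<close>

lemma order_nothing_policy: "(10, restrict (\<lambda>d. 10 - d) {0..}) \<in> policies ex"
  by (auto simp: policies_def example_inventory_def
      intro!: measurable_restrict_space1 cong: measurable_cong_simp)

lemma static_value_18: "static_value ex = 18"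
proof (rule antisym)
  have "static_value ex \<le> worst_case_cost ex (10, restrict (\<lambda>d. 10 - d) {0..})"
    unfolding static_value_def by (rule INF_lower[OF order_nothing_policy])
  also have "\<dots> \<le> 18"
    by (rule worst_case_cost_18[OF order_nothing_policy]) simp_all
  finally show "static_value ex \<le> 18" .
  show "18 \<le> static_value ex"
    unfolding static_value_def using worst_case_cost_ge(1) by (auto intro!: INF_greatest)
qed

lemma static_optimal_eq:
  "static_optimal ex = {(x1, x2) \<in> policies ex. x1 = 10 \<and> x2 1 = 9 \<and> x2 3 = 7}"
proof -
  have "worst_case_cost ex (x1, x2) = 18 \<longleftrightarrow> x1 = 10 \<and> x2 1 = 9 \<and> x2 3 = 7"
    if "(x1, x2) \<in> policies ex" for x1 x2
    using that worst_case_cost_18 worst_case_cost_ge by (blast intro: antisym)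
  then show ?thesis unfolding static_optimal_def static_value_18 by auto
qed

theorem theorem5:
  "static_optimal example_inventory =
     {(x1, x2) \<in> policies example_inventory. x1 = 10 \<and> x2 1 = 9 \<and> x2 3 = 7} \<and>
   static_value example_inventory = 18 \<and>
   dp_optimal example_inventory \<subseteq>
     {(x1, x2) \<in> policies example_inventory. x1 = 10 \<and> x2 1 = 9 \<and> x2 3 = 8} \<and>
   dp_value example_inventory = ennreal (17 + sqrt 5 / 2) \<and>
   17 + sqrt 5 / 2 > 18 \<and>
   \<not> weakly_time_consistent example_inventory \<and>
   static_value example_inventory \<noteq> dp_value example_inventory"
proof -
  have dp: "dp_value ex = ennreal (17 + sqrt 5 / 2)"
    using value_first by (simp add: dp_value_def dp_cost_10 example_inventory_def)
  have "2 < sqrt 5" by (rule real_less_rsqrt) simp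
  then have gt: "17 + sqrt 5 / 2 > 18" by simp
  then have "ennreal 18 < ennreal (17 + sqrt 5 / 2)" by (intro ennreal_lessI) auto
  then have "static_value ex \<noteq> dp_value ex" unfolding dp static_value_18 by simp
  \<comment> \<open>A time consistent policy would need \<open>x2 3\<close> to be both 7 and
    8.\<close>
  moreover have "\<not> weakly_time_consistent ex"
    using dp_optimal_subset static_optimal_eq
    by (auto simp: weakly_time_consistent_def time_consistent_def)
  ultimately show ?thesis
    using static_optimal_eq static_value_18 dp_optimal_subset dp gt by blast
qed

end
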